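(* Let the stopping models $\mathcal{N}$ and $\mathcal{N}^*$ each be uniparametric and closed under pgf composition, and let $\mathcal{N}$ and $\mathcal{N}^*$ be a pair of extreme reversible models. Then the two distinct statistically stable model extensions obtained with $\mathcal{N}$, namely $max_{\mathcal{N}}(max^{-1}_{\mathcal{N}}(\cdot))=max^{-1}_{\mathcal{N}}(max_{\mathcal{N}}(\cdot))$ and $min_{\mathcal{N}}(min^{-1}_{\mathcal{N}}(\cdot))=min^{-1}_{\mathcal{N}}(min_{\mathcal{N}}(\cdot))$, and the two obtained with $\mathcal{N}^*$, namely $max_{\mathcal{N}^*}(max^{-1}_{\mathcal{N}^*}(\cdot))=max^{-1}_{\mathcal{N}^*}(max_{\mathcal{N}^*}(\cdot))$ and $min_{\mathcal{N}^*}(min^{-1}_{\mathcal{N}^*}(\cdot))=min^{-1}_{\mathcal{N}^*}(min_{\mathcal{N}^*}(\cdot))$, are the same (as a set of model transformations).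
   Context: A statistical model $\mathcal{X}=\{X_\theta:\theta\in\Theta\}$ is a family of real random variables, identified with the set of their cumulative distribution functions $F_{X_\theta}$. Models are compared as sets of distributions, and two model transformations are the same if they agree on every statistical model. A stopping model $\mathcal{N}=\{N_\delta:\delta\in\mathcal{D}\}$ is a family of positive integer valued random variables ($\Pr(N_\delta=0)=0$), with probability generating functions (pgfs) $h_{N_\delta}(t)=\sum_{i\ge1}p_i(\delta)t^i$, $p_i(\delta)=\Pr(N_\delta=i)$, $t\in[0,1]$. Each $h_{N_\delta}$ is an increasing bijection of $[0,1]$ with inverse $h_{N_\delta}^{-1}$, and $\overline{h}_{N_\delta}(t)=1-h_{N_\delta}(1-t)$ is its conjugate, with inverse $\overline{h}_{N_\delta}^{-1}$. $\mathcal{N}$ is closed under pgf composition if for all $N_{\delta_1},N_{\delta_2}\in\mathcal{N}$ the random variable with pgf $h_{N_{\delta_1}}\circ h_{N_{\delta_2}}$ belongs to $\mathcal{N}$. $\mathcal{N}$ is "uniparametric and closed under pgf composition" if it is closed under pgf composition and has a parametrization $\delta\in\mathcal{D}$ in which every $p_i(\delta)$ is continuously differentiable in $\delta$ and $\mathcal{D}$ is a connected subset of $\mathbb{R}$ with non-empty interior. By the paper's standing convention such models are parametrized by $\eta=-\log\Pr(N_\eta=1)$ (with $\Pr(N_\eta=1)>0$), with parameter space $[\eta_0,\infty)$ for some $\eta_0\ge0$, each $\eta$ corresponding to exactly one distribution in the model. A pair $(N,N^* )$ of positive integer valued random variables is extreme reversible if $\overline{h}_N^{-1}=h_{N^*}$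 (equivalently $h_N^{-1}=\overline{h}_{N^*}$). If $\mathcal{N}^*$ is the set of all random variables $N^*$ that are extreme reversible with a random variable in $\mathcal{N}$, then $\mathcal{N}$ and $\mathcal{N}^*$ are a pair of extreme reversible models. Combined transformations: $max_{\mathcal{N}}(max^{-1}_{\mathcal{N}}(\mathcal{X}))$, $max^{-1}_{\mathcal{N}}(max_{\mathcal{N}}(\mathcal{X}))$, $min_{\mathcal{N}}(min^{-1}_{\mathcal{N}}(\mathcal{X}))$, $min^{-1}_{\mathcal{N}}(min_{\mathcal{N}}(\mathcal{X}))$ consist of the random variables with cdfs, respectively, $h_{N_{\delta_2}}\circ h^{-1}_{N_{\delta_1}}(F_{X_\theta})$, $h^{-1}_{N_{\delta_2}}\circ h_{N_{\delta_1}}(F_{X_\theta})$, $\overline{h}_{N_{\delta_2}}\circ\overline{h}^{-1}_{N_{\delta_1}}(F_{X_\theta})$, $\overline{h}^{-1}_{N_{\delta_2}}\circ\overline{h}_{N_{\delta_1}}(F_{X_\theta})$, for $\theta\in\Theta$ and $\delta_1,\delta_2\in\mathcal{D}$. For a model that is uniparametric and closed under pgf composition, the first two of these coincide and the last two coincide, and they are statistically stable model extensions ($\mathcal{T}(\mathcal{T}(\mathcal{X}))=\mathcal{T}(\mathcal{X})\supseteq\mathcal{X}$ for every $\mathcal{X}$). *)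

theory Defs
  imports "HOL-Probability.Probability"
begin

text \<open>
  Random variables enter only through their laws: a positive integer valued random variable is a
  \<^typ>\<open>nat pmf\<close> without mass at 0, a stopping model is a set of such pmfs, and a statistical model is
  a set of cumulative distribution functions.
\<close>

definition positive_valued :: "nat pmf \<Rightarrow> bool" where
  "positive_valued N \<longleftrightarrow> pmf N 0 = 0"

definition stopping_model :: "nat pmf set \<Rightarrow> bool" where
  "stopping_model \<N> \<longleftrightarrow> (\<forall>N\<in>\<N>. positive_valued N)"

text \<open>
  The functions below are meaningful on the unit interval only, and the inverses are inverses of
  the restrictions to it.
\<close>

definition pgf :: "nat pmf \<Rightarrow> real \<Rightarrow> real" where
  "pgf N t = (\<Sum>i. pmf N i * t ^ i)"

definition pgf_inv :: "nat pmf \<Rightarrow> real \<Rightarrow> real" where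
  "pgf_inv N = inv_into {0..1} (pgf N)"

definition conj_pgf :: "nat pmf \<Rightarrow> real \<Rightarrow> real" where
  "conj_pgf N t = 1 - pgf N (1 - t)"

definition conj_pgf_inv :: "nat pmf \<Rightarrow> real \<Rightarrow> real" where
  "conj_pgf_inv N = inv_into {0..1} (conj_pgf N)"

definition closed_under_pgf_composition :: "nat pmf set \<Rightarrow> bool" where
  "closed_under_pgf_composition \<N> \<longleftrightarrow>
     (\<forall>N1\<in>\<N>. \<forall>N2\<in>\<N>. \<exists>N\<in>\<N>. \<forall>t\<in>{0..1}. pgf N t = pgf N1 (pgf N2 t))"

text \<open>
  Differentiability is relative to the parameter space, hence one-sided at an end point that
  belongs to it.
\<close>

definition continuously_differentiable_on :: "(real \<Rightarrow> real) \<Rightarrow> real set \<Rightarrow> bool" where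
  "continuously_differentiable_on f D \<longleftrightarrow>
     (\<exists>f'. continuous_on D f' \<and> (\<forall>x\<in>D. (f has_real_derivative f' x) (at x within D)))"

definition uniparametric :: "nat pmf set \<Rightarrow> bool" where
  "uniparametric \<N> \<longleftrightarrow>
     (\<exists>(D :: real set) (N :: real \<Rightarrow> nat pmf).
        connected D \<and> interior D \<noteq> {} \<and> \<N> = N ` D \<and>
        (\<forall>i\<ge>1. continuously_differentiable_on (\<lambda>\<delta>. pmf (N \<delta>) i) D))"

definition uniparametric_pgf_closed :: "nat pmf set \<Rightarrow> bool" where
  "uniparametric_pgf_closed \<N> \<longleftrightarrow>
     stopping_model \<N> \<and> uniparametric \<N> \<and> closed_under_pgf_composition \<N>"

text \<open>
  The standing convention for such models: the law is determined by \<open>\<eta> = - ln Pr(N = 1)\<close>, and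
  \<open>\<eta>\<close> ranges over a closed half-line. It does not follow from the preceding definition, so it is
  a separate hypothesis.
\<close>

definition eta_parametrized :: "nat pmf set \<Rightarrow> bool" where
  "eta_parametrized \<N> \<longleftrightarrow>
     (\<forall>N\<in>\<N>. pmf N 1 > 0) \<and>
     (\<exists>\<eta>0\<ge>0. bij_betw (\<lambda>N. - ln (pmf N 1)) \<N> {\<eta>0..})"

definition extreme_reversible :: "nat pmf \<Rightarrow> nat pmf \<Rightarrow> bool" where
  "extreme_reversible N N' \<longleftrightarrow>
     positive_valued N \<and> positive_valued N' \<and> (\<forall>t\<in>{0..1}. conj_pgf_inv N t = pgf N' t)"

definition extreme_reversible_models :: "nat pmf set \<Rightarrow> nat pmf set \<Rightarrow> bool" where
  "extreme_reversible_models \<N> \<N>' \<longleftrightarrow> \<N>' = {N'. \<exists>N\<in>\<N>. extreme_reversible N N'}"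

definition statistical_models :: "(real \<Rightarrow> real) set set" where
  "statistical_models = Pow {cdf M | M. real_distribution M}"

definition max_tr :: "nat pmf set \<Rightarrow> (real \<Rightarrow> real) set \<Rightarrow> (real \<Rightarrow> real) set" where
  "max_tr \<N> \<X> = {pgf N \<circ> F | N F. N \<in> \<N> \<and> F \<in> \<X>}"

definition max_inv_tr :: "nat pmf set \<Rightarrow> (real \<Rightarrow> real) set \<Rightarrow> (real \<Rightarrow> real) set" where
  "max_inv_tr \<N> \<X> = {pgf_inv N \<circ> F | N F. N \<in> \<N> \<and> F \<in> \<X>}"

definition min_tr :: "nat pmf set \<Rightarrow> (real \<Rightarrow> real) set \<Rightarrow> (real \<Rightarrow> real) set" where
  "min_tr \<N> \<X> = {conj_pgf N \<circ> F | N F. N \<in> \<N> \<and> F \<in> \<X>}"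

definition min_inv_tr :: "nat pmf set \<Rightarrow> (real \<Rightarrow> real) set \<Rightarrow> (real \<Rightarrow> real) set" where
  "min_inv_tr \<N> \<X> = {conj_pgf_inv N \<circ> F | N F. N \<in> \<N> \<and> F \<in> \<X>}"

text \<open>
  The combined transformations are restricted to statistical models, so that equality of
  transformations is agreement on every statistical model.
\<close>

definition max_max_inv :: "nat pmf set \<Rightarrow> (real \<Rightarrow> real) set \<Rightarrow> (real \<Rightarrow> real) set" where
  "max_max_inv \<N> = (\<lambda>\<X>\<in>statistical_models. max_tr \<N> (max_inv_tr \<N> \<X>))"

definition max_inv_max :: "nat pmf set \<Rightarrow> (real \<Rightarrow> real) set \<Rightarrow> (real \<Rightarrow> real) set" where
  "max_inv_max \<N> = (\<lambda>\<X>\<in>statistical_models. max_inv_tr \<N> (max_tr \<N> \<X>))"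

definition min_min_inv :: "nat pmf set \<Rightarrow> (real \<Rightarrow> real) set \<Rightarrow> (real \<Rightarrow> real) set" where
  "min_min_inv \<N> = (\<lambda>\<X>\<in>statistical_models. min_tr \<N> (min_inv_tr \<N> \<X>))"

definition min_inv_min :: "nat pmf set \<Rightarrow> (real \<Rightarrow> real) set \<Rightarrow> (real \<Rightarrow> real) set" where
  "min_inv_min \<N> = (\<lambda>\<X>\<in>statistical_models. min_inv_tr \<N> (min_tr \<N> \<X>))"

definition stable_extension :: "((real \<Rightarrow> real) set \<Rightarrow> (real \<Rightarrow> real) set) \<Rightarrow> bool" where
  "stable_extension T \<longleftrightarrow>
     (\<forall>\<X>\<in>statistical_models. T \<X> \<in> statistical_models \<and> T (T \<X>) = T \<X> \<and> \<X> \<subseteq> T \<X>)"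

end

theory Submission
  imports Defs
begin

text \<open>
  The derivative of a pgf at 0 is \<open>Pr(N = 1)\<close>, so \<open>\<eta>\<close> adds up when pgfs are composed. As \<open>\<eta>\<close>
  determines the law, closure gives \<open>h\<^sub>a \<circ> h\<^sub>b = h\<^sub>a\<^sub>+\<^sub>b = h\<^sub>b \<circ> h\<^sub>a\<close>, where \<open>h\<^sub>a\<close> is the pgf with
  parameter \<open>a\<close>. Hence the pgfs of the model form a commutative semigroup of increasing bijections of
  the unit interval, in which \<open>h\<^sub>a\<close> and \<open>h\<^sub>b\<inverse>\<close> commute and the quotients \<open>h\<^sub>a h\<^sub>b\<inverse>\<close> are closed
  under composition. This gives the equality of the two orders and stability, and conjugation
  carries both over to the transformations with minima
  (\<open>commuting_reparams.quotient_tr_swap\<close>, \<open>commuting_reparams.stable_quotient_tr\<close>).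

  For the last claim, a partner \<open>N'\<close> of \<open>N\<close> has \<open>pgf N'\<close> inverse to \<open>conj_pgf N\<close> and \<open>conj_pgf N'\<close>
  inverse to \<open>pgf N\<close>. Passing to inverses only exchanges numerators and denominators of quotients,
  so the extension with maxima for \<open>\<N>'\<close> should be the one with minima for \<open>\<N>\<close>, and vice versa.

  The difficulty is that the pair condition does not give every member of \<open>\<N>\<close> a partner: \<open>\<N>'\<close>
  collects the partners that exist. As \<open>h\<^sub>a h\<^sub>b\<inverse> = h\<^sub>a\<^sub>+\<^sub>c h\<^sub>b\<^sub>+\<^sub>c\<inverse>\<close>, it is enough that all members
  with large \<open>\<eta>\<close> have one (\<open>quotient_tr_eq_of_cofinal_inverses\<close>). Consider the relation between the
  parameters of partners. It is additive, because composition is respected by partners. Also,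
  composing with a further pgf decreases a pgf, and taking inverses of conjugates preserves the order
  of pgfs, so a parameter that exceeds another one by enough has a partner parameter that is at least
  as large. An additive relation with such coarse monotonicity is linear, say \<open>\<eta>' = c \<eta>\<close>
  (\<open>coarsely_monotone_additive_proportional\<close>). Every member of \<open>\<N>'\<close> is a partner and its
  parameters fill a half-line, so the parameters in \<open>\<N>\<close> that have a partner fill a half-line as well
  (\<open>partners_eventually\<close>).
\<close>

section \<open>Increasing reparametrizations of the unit interval\<close>

definition unit_reparam :: "(real \<Rightarrow> real) \<Rightarrow> bool" where
  "unit_reparam f \<longleftrightarrow> continuous_on {0..1} f \<and> strict_mono_on {0..1} f \<and> f 0 = 0 \<and> f 1 = 1"

abbreviation unit_inv :: "(real \<Rightarrow> real) \<Rightarrow> real \<Rightarrow> real" where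
  "unit_inv f \<equiv> inv_into {0..1} f"

lemma unit_reparam_less:
  assumes "unit_reparam f" "s \<in> {0..1}" "t \<in> {0..1}"
  shows "f s < f t \<longleftrightarrow> s < t"
proof -
  have "strict_mono_on {0..1} f" using assms(1) by (simp add: unit_reparam_def)
  from strict_mono_onD[OF this assms(2,3)] strict_mono_onD[OF this assms(3,2)] show ?thesis
    by (cases s t rule: linorder_cases) auto
qed

lemma unit_reparam_le:
  "unit_reparam f \<Longrightarrow> s \<in> {0..1} \<Longrightarrow> t \<in> {0..1} \<Longrightarrow> f s \<le> f t \<longleftrightarrow> s \<le> t"
  using unit_reparam_less[of f t s] by linarith

lemma unit_reparam_inj_on: "unit_reparam f \<Longrightarrow> inj_on f {0..1}"
  by (simp add: unit_reparam_def strict_mono_on_imp_inj_on)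

lemma unit_reparam_mem: "unit_reparam f \<Longrightarrow> t \<in> {0..1} \<Longrightarrow> f t \<in> {0..1}"
  using unit_reparam_le[of f 0 t] unit_reparam_le[of f t 1] by (auto simp: unit_reparam_def)

lemma unit_reparam_image: "unit_reparam f \<Longrightarrow> f ` {0..1} = {0..1}"
proof
  assume f: "unit_reparam f"
  show "f ` {0..1} \<subseteq> {0..1}"
    using unit_reparam_mem[OF f] by blast
  show "{0..1} \<subseteq> f ` {0..1}"
  proof
    fix t :: real assume "t \<in> {0..1}"
    then obtain s where "0 \<le> s" "s \<le> 1" "f s = t"
      using IVT'[of f 0 t 1] f by (auto simp: unit_reparam_def)
    then show "t \<in> f ` {0..1}" by auto
  qed
qed

lemma unit_inv_mem: "unit_reparam f \<Longrightarrow> t \<in> {0..1} \<Longrightarrow> unit_inv f t \<in> {0..1}"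
  by (rule inv_into_into) (simp add: unit_reparam_image)

lemma reparam_unit_inv: "unit_reparam f \<Longrightarrow> t \<in> {0..1} \<Longrightarrow> f (unit_inv f t) = t"
  by (rule f_inv_into_f) (simp add: unit_reparam_image)

lemma unit_inv_eqI: "unit_reparam f \<Longrightarrow> s \<in> {0..1} \<Longrightarrow> f s = t \<Longrightarrow> unit_inv f t = s"
  using inv_into_f_f[OF unit_reparam_inj_on] by auto

lemma unit_reparam_unit_inv:
  assumes "unit_reparam f"
  shows "unit_reparam (unit_inv f)"
  unfolding unit_reparam_def
proof (intro conjI)
  have "continuous_on (f ` {0..1}) (unit_inv f)"
    using assms unit_inv_eqI[OF assms]
    by (intro continuous_on_inv) (auto simp: unit_reparam_def)
  then show "continuous_on {0..1} (unit_inv f)"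
    by (simp add: unit_reparam_image[OF assms])
  show "strict_mono_on {0..1} (unit_inv f)"
  proof (rule strict_mono_onI)
    fix s t :: real assume st: "s \<in> {0..1}" "t \<in> {0..1}" "s < t"
    then show "unit_inv f s < unit_inv f t"
      using unit_reparam_less[OF assms unit_inv_mem[OF assms] unit_inv_mem[OF assms], of s t]
      by (simp add: reparam_unit_inv[OF assms])
  qed
  show "unit_inv f 0 = 0" "unit_inv f 1 = 1"
    using assms by (auto intro!: unit_inv_eqI simp: unit_reparam_def)
qed

lemma unit_reparam_conjugate:
  assumes "unit_reparam f"
  shows "unit_reparam (\<lambda>t. 1 - f (1 - t))"
  unfolding unit_reparam_def
proof (intro conjI)
  have "continuous_on {0..1} (\<lambda>t. f (1 - t))"
  proof (rule continuous_on_compose2[of "{0..1}" f])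
    show "continuous_on {0..1} f" using assms by (simp only: unit_reparam_def)
  qed (auto intro: continuous_on_diff continuous_on_const continuous_on_id)
  then show "continuous_on {0..1} (\<lambda>t. 1 - f (1 - t))"
    by (rule continuous_on_diff[OF continuous_on_const])
  show "strict_mono_on {0..1} (\<lambda>t. 1 - f (1 - t))"
  proof (rule strict_mono_onI)
    fix s t :: real assume "s \<in> {0..1}" "t \<in> {0..1}" "s < t"
    then show "1 - f (1 - s) < 1 - f (1 - t)"
      using unit_reparam_less[OF assms, of "1 - t" "1 - s"] by simp
  qed
qed (use assms in \<open>auto simp: unit_reparam_def\<close>)

lemma cdf_mem:
  assumes "real_distribution M"
  shows "cdf M x \<in> {0..1}"
proof -
  interpret real_distribution M by fact
  show ?thesis using cdf_nonneg cdf_bounded_prob by simp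
qed

text \<open>
  The reparametrization is continuous and increasing, so it preserves monotonicity and right
  continuity, and it fixes 0 and 1, so it preserves the limits at both ends.
\<close>

lemma statistical_models_reparam:
  assumes "{F} \<in> statistical_models" and f: "unit_reparam f"
  shows "{f \<circ> F} \<in> statistical_models"
proof -
  obtain M where M: "real_distribution M" and F: "F = cdf M"
    using assms(1) by (auto simp: statistical_models_def)
  interpret real_distribution M by fact
  have mem: "F x \<in> {0..1}" for x
    using cdf_mem[OF M] F by simp
  have lim: "((\<lambda>x. f (F x)) \<longlongrightarrow> f l) G" if "(F \<longlongrightarrow> l) G" "l \<in> {0..1}" for l G
    using f that mem
    by (intro continuous_on_tendsto_compose[of "{0..1}" f]) (auto simp: unit_reparam_def)
  have nondec: "(f \<circ> F) x \<le> (f \<circ> F) y" if "x \<le> y" for x y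
    using unit_reparam_le[OF f mem mem] cdf_nondecreasing[OF that] F by simp
  have right: "continuous (at_right a) (f \<circ> F)" for a
    using cdf_is_right_cont[of a] lim[OF _ mem] F by (simp add: continuous_within o_def)
  have bot: "((f \<circ> F) \<longlongrightarrow> 0) at_bot"
    using lim[of 0 at_bot] cdf_lim_at_bot F f by (simp add: o_def unit_reparam_def)
  have top: "((f \<circ> F) \<longlongrightarrow> 1) at_top"
    using lim[of 1 at_top] cdf_lim_at_top_prob F f by (simp add: o_def unit_reparam_def)
  have "real_distribution (interval_measure (f \<circ> F))"
    using nondec right bot top by (rule real_distribution_interval_measure)
  moreover have "cdf (interval_measure (f \<circ> F)) = f \<circ> F"
    using nondec right bot by (rule cdf_interval_measure)
  ultimately show ?thesis
    by (force simp: statistical_models_def)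
qed

lemma statistical_models_iff: "\<X> \<in> statistical_models \<longleftrightarrow> (\<forall>F\<in>\<X>. {F} \<in> statistical_models)"
  by (auto simp: statistical_models_def)

lemma statistical_models_mem: "\<X> \<in> statistical_models \<Longrightarrow> F \<in> \<X> \<Longrightarrow> F x \<in> {0..1}"
  using cdf_mem by (fastforce simp: statistical_models_def)

section \<open>Quotients of a commuting composition semigroup\<close>

text \<open>
  Applied to \<open>pgf ` \<N>\<close> this is the combined transformation with maxima, and to \<open>conj_pgf ` \<N>\<close> the one
  with minima.
\<close>

definition quotient_tr :: "(real \<Rightarrow> real) set \<Rightarrow> (real \<Rightarrow> real) set \<Rightarrow> (real \<Rightarrow> real) set" where
  "quotient_tr S \<X> = {f \<circ> (unit_inv g \<circ> F) | f g F. f \<in> S \<and> g \<in> S \<and> F \<in> \<X>}"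

text \<open>
  The elements are functions on the whole real line that matter on the unit interval only, so the
  composition of two of them is required to agree with an element there, not to be one.
\<close>

locale commuting_reparams =
  fixes S :: "(real \<Rightarrow> real) set"
  assumes nonempty: "S \<noteq> {}"
    and reparam: "f \<in> S \<Longrightarrow> unit_reparam f"
    and closed: "f \<in> S \<Longrightarrow> g \<in> S \<Longrightarrow> \<exists>h\<in>S. \<forall>t\<in>{0..1}. h t = f (g t)"
    and commute: "f \<in> S \<Longrightarrow> g \<in> S \<Longrightarrow> t \<in> {0..1} \<Longrightarrow> f (g t) = g (f t)"
begin

lemmas mem = unit_reparam_mem[OF reparam]
lemmas inv_mem = unit_inv_mem[OF reparam]
lemmas apply_inv = reparam_unit_inv[OF reparam]
lemmas inv_eqI = unit_inv_eqI[OF reparam]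

lemma inv_apply: "f \<in> S \<Longrightarrow> t \<in> {0..1} \<Longrightarrow> unit_inv f (f t) = t"
  by (simp add: inv_eqI del: atLeastAtMost_iff)

lemma commute_inv:
  assumes "f \<in> S" "g \<in> S" "t \<in> {0..1}"
  shows "f (unit_inv g t) = unit_inv g (f t)"
proof (rule inv_eqI[symmetric])
  show "g (f (unit_inv g t)) = f t"
    using assms by (simp add: commute[of g f] inv_mem apply_inv del: atLeastAtMost_iff)
qed (use assms in \<open>simp_all add: mem inv_mem del: atLeastAtMost_iff\<close>)

lemma quotient_tr_swap:
  assumes "\<X> \<in> statistical_models"
  shows "quotient_tr S \<X> = {unit_inv g \<circ> (f \<circ> F) | f g F. f \<in> S \<and> g \<in> S \<and> F \<in> \<X>}"
proof -
  have eq: "f \<circ> (unit_inv g \<circ> F) = unit_inv g \<circ> (f \<circ> F)" if "f \<in> S" "g \<in> S" "F \<in> \<X>" for f g F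
    using commute_inv[OF that(1,2) statistical_models_mem[OF assms that(3)]] by (simp add: fun_eq_iff)
  show ?thesis
    unfolding quotient_tr_def by (intro Collect_cong ex_cong1) (auto simp: eq)
qed

lemma quotient_tr_statistical:
  assumes "\<X> \<in> statistical_models"
  shows "quotient_tr S \<X> \<in> statistical_models"
proof -
  have "{f \<circ> (unit_inv g \<circ> F)} \<in> statistical_models" if "f \<in> S" "g \<in> S" "F \<in> \<X>" for f g F
  proof -
    have "{F} \<in> statistical_models"
      using assms that(3) statistical_models_iff[of \<X>] by blast
    then have "{unit_inv g \<circ> F} \<in> statistical_models"
      by (rule statistical_models_reparam[OF _ unit_reparam_unit_inv[OF reparam[OF that(2)]]])
    then show ?thesis by (rule statistical_models_reparam[OF _ reparam[OF that(1)]])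
  qed
  then show ?thesis
    by (subst statistical_models_iff) (auto simp: quotient_tr_def)
qed

lemma quotient_tr_extensive:
  assumes "\<X> \<in> statistical_models"
  shows "\<X> \<subseteq> quotient_tr S \<X>"
proof
  fix F assume F: "F \<in> \<X>"
  obtain f where f: "f \<in> S" using nonempty by blast
  have "f \<circ> (unit_inv f \<circ> F) = F"
    using apply_inv[OF f statistical_models_mem[OF assms F]] by (simp add: fun_eq_iff)
  then show "F \<in> quotient_tr S \<X>"
    unfolding quotient_tr_def using f F by (intro CollectI exI[of _ f] exI[of _ F]) simp
qed

text \<open>
  Commutativity gives \<open>(f1 / g1) (f2 / g2) = (f1 f2) / (g1 g2)\<close>, so quotients are closed under
  composition.
\<close>

lemma quotient_tr_idem:
  assumes "\<X> \<in> statistical_models"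
  shows "quotient_tr S (quotient_tr S \<X>) = quotient_tr S \<X>"
proof
  show "quotient_tr S \<X> \<subseteq> quotient_tr S (quotient_tr S \<X>)"
    by (rule quotient_tr_extensive[OF quotient_tr_statistical[OF assms]])
  show "quotient_tr S (quotient_tr S \<X>) \<subseteq> quotient_tr S \<X>"
  proof
    fix G assume "G \<in> quotient_tr S (quotient_tr S \<X>)"
    then obtain f1 g1 f2 g2 F where S: "f1 \<in> S" "g1 \<in> S" "f2 \<in> S" "g2 \<in> S" and F: "F \<in> \<X>"
      and G: "G = f1 \<circ> (unit_inv g1 \<circ> (f2 \<circ> (unit_inv g2 \<circ> F)))"
      unfolding quotient_tr_def by blast
    obtain h where h: "h \<in> S" "\<And>t. t \<in> {0..1} \<Longrightarrow> h t = f1 (f2 t)"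
      using closed[OF S(1,3)] by blast
    obtain k where k: "k \<in> S" "\<And>t. t \<in> {0..1} \<Longrightarrow> k t = g2 (g1 t)"
      using closed[OF S(4,2)] by blast
    have "G x = h (unit_inv k (F x))" for x
    proof -
      have F01: "F x \<in> {0..1}" using statistical_models_mem[OF assms F] .
      define r where "r = unit_inv g1 (unit_inv g2 (F x))"
      have r01: "r \<in> {0..1}" using F01 S by (simp add: r_def inv_mem del: atLeastAtMost_iff)
      have "k r = F x"
        using k(2)[OF r01] F01 S by (simp add: r_def inv_mem apply_inv del: atLeastAtMost_iff)
      then have r: "unit_inv k (F x) = r" by (rule inv_eqI[OF k(1) r01])
      have "G x = f1 (f2 r)"
        using F01 S by (simp add: G r_def commute_inv inv_mem del: atLeastAtMost_iff)
      then show ?thesis using r h(2)[OF r01] by simp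
    qed
    then have "G = h \<circ> (unit_inv k \<circ> F)" by (simp add: fun_eq_iff)
    then show "G \<in> quotient_tr S \<X>"
      unfolding quotient_tr_def using h(1) k(1) F by blast
  qed
qed

lemma stable_quotient_tr: "stable_extension (\<lambda>\<X>\<in>statistical_models. quotient_tr S \<X>)"
  by (simp add: stable_extension_def quotient_tr_statistical quotient_tr_idem quotient_tr_extensive)

end

text \<open>
  Passing to inverses leaves the set of quotients unchanged. Not all of \<open>S\<close> has to be inverted by
  \<open>S'\<close>: a quotient of two elements may be expanded by a common factor \<open>k\<close>, so it is enough that such
  a factor moves both of them into the inverted part.
\<close>

lemma quotient_tr_eq_of_cofinal_inverses:
  assumes "commuting_reparams S" "commuting_reparams S'"
    and inverse: "\<And>f'. f' \<in> S' \<Longrightarrow> \<exists>f\<in>S. \<forall>t\<in>{0..1}. f' t = unit_inv f t"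
    and cofinal: "\<And>f g. f \<in> S \<Longrightarrow> g \<in> S \<Longrightarrow>
      \<exists>k\<in>S. \<exists>f'\<in>S'. \<exists>g'\<in>S'. \<forall>t\<in>{0..1}. f' (f (k t)) = t \<and> g' (g (k t)) = t"
    and X: "\<X> \<in> statistical_models"
  shows "quotient_tr S' \<X> = quotient_tr S \<X>"
proof -
  interpret S: commuting_reparams S by fact
  interpret S': commuting_reparams S' by fact
  show ?thesis
  proof
    show "quotient_tr S' \<X> \<subseteq> quotient_tr S \<X>"
    proof
      fix G assume "G \<in> quotient_tr S' \<X>"
      then obtain f' g' F where S': "f' \<in> S'" "g' \<in> S'" and F: "F \<in> \<X>"
        and G: "G = f' \<circ> (unit_inv g' \<circ> F)"
        unfolding quotient_tr_def by blast
      obtain f where f: "f \<in> S" "\<And>t. t \<in> {0..1} \<Longrightarrow> f' t = unit_inv f t"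
        using inverse[OF S'(1)] by blast
      obtain g where g: "g \<in> S" "\<And>t. t \<in> {0..1} \<Longrightarrow> g' t = unit_inv g t"
        using inverse[OF S'(2)] by blast
      have "G x = g (unit_inv f (F x))" for x
      proof -
        have F01: "F x \<in> {0..1}" using statistical_models_mem[OF X F] .
        have "unit_inv g' (F x) = g (F x)"
          using F01 g by (intro S'.inv_eqI[OF S'(2)]) (simp_all add: S.mem S.inv_apply del: atLeastAtMost_iff)
        then show ?thesis
          using F01 f g by (simp add: G S.mem S.commute_inv del: atLeastAtMost_iff)
      qed
      then have "G = g \<circ> (unit_inv f \<circ> F)" by (simp add: fun_eq_iff)
      then show "G \<in> quotient_tr S \<X>"
        unfolding quotient_tr_def using f(1) g(1) F by blast
    qed
    show "quotient_tr S \<X> \<subseteq> quotient_tr S' \<X>"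
    proof
      fix G assume "G \<in> quotient_tr S \<X>"
      then obtain f g F where S: "f \<in> S" "g \<in> S" and F: "F \<in> \<X>"
        and G: "G = f \<circ> (unit_inv g \<circ> F)"
        unfolding quotient_tr_def by blast
      obtain k f' g' where k: "k \<in> S" and S': "f' \<in> S'" "g' \<in> S'"
        and f': "\<And>t. t \<in> {0..1} \<Longrightarrow> f' (f (k t)) = t"
        and g': "\<And>t. t \<in> {0..1} \<Longrightarrow> g' (g (k t)) = t"
        using cofinal[OF S] by blast
      have "G x = g' (unit_inv f' (F x))" for x
      proof -
        have F01: "F x \<in> {0..1}" using statistical_models_mem[OF X F] .
        define r where "r = unit_inv k (unit_inv g (F x))"
        have r01: "r \<in> {0..1}" using F01 S k by (simp add: r_def S.inv_mem del: atLeastAtMost_iff)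
        have kr: "k r = unit_inv g (F x)"
          using F01 S k by (simp add: r_def S.inv_mem S.apply_inv del: atLeastAtMost_iff)
        then have "g (k r) = F x"
          using F01 S by (simp add: S.apply_inv del: atLeastAtMost_iff)
        then have "g' (F x) = r" using g'[OF r01] by simp
        moreover have "unit_inv f' r = f (k r)"
          using S'.inv_eqI[OF S'(1) _ f'[OF r01]] S k r01 by (simp add: S.mem del: atLeastAtMost_iff)
        ultimately show ?thesis
          using F01 S' kr by (simp add: G S'.commute_inv)
      qed
      then have "G = g' \<circ> (unit_inv f' \<circ> F)" by (simp add: fun_eq_iff)
      then show "G \<in> quotient_tr S' \<X>"
        unfolding quotient_tr_def using S' F by blast
    qed
  qed
qed

section \<open>Probability generating functions\<close>

lemma sums_pmf_nat: "pmf (N :: nat pmf) sums 1"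
  using sums_infsetsum_nat'[OF pmf_abs_summable, of N] infsetsum_pmf_eq_1[of N UNIV] by simp

lemma summable_pgf:
  fixes N :: "nat pmf"
  assumes "norm t \<le> (1::real)"
  shows "summable (\<lambda>i. pmf N i * t ^ i)"
proof (rule summable_comparison_test)
  show "\<exists>n0. \<forall>n\<ge>n0. norm (pmf N n * t ^ n) \<le> pmf N n"
    using assms power_le_one[of "norm t"]
    by (auto simp: abs_mult power_abs intro!: mult_left_le)
  show "summable (pmf N)" using sums_pmf_nat sums_summable by blast
qed

lemma pgf_0: "positive_valued N \<Longrightarrow> pgf N 0 = 0"
  by (simp add: pgf_def positive_valued_def)

lemma pgf_1: "pgf N 1 = 1"
  using sums_pmf_nat[of N] by (simp add: pgf_def sums_iff)

lemma continuous_on_pgf: "continuous_on {0..1} (pgf N)"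
proof -
  have "uniform_limit {0..1} (\<lambda>n t. \<Sum>i<n. pmf N i * t ^ i) (\<lambda>t. \<Sum>i. pmf N i * t ^ i) sequentially"
    using sums_pmf_nat sums_summable
    by (intro Weierstrass_m_test[where M="pmf N"])
       (auto simp: abs_mult power_abs intro!: mult_left_le power_le_one)
  then have "continuous_on {0..1} (\<lambda>t. \<Sum>i. pmf N i * t ^ i)"
    by (rule uniform_limit_theorem[rotated]) (simp_all add: continuous_on_sum continuous_on_mult continuous_on_power)
  then show ?thesis by (simp add: pgf_def[abs_def])
qed

lemma pgf_increment_ge:
  assumes "0 \<le> s" "s \<le> t" "t \<le> 1"
  shows "pmf N 1 * (t - s) \<le> pgf N t - pgf N s"
proof -
  have summable: "summable (\<lambda>i. pmf N i * t ^ i)" "summable (\<lambda>i. pmf N i * s ^ i)"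
    using assms by (auto intro: summable_pgf)
  have "sum (\<lambda>i. pmf N i * t ^ i - pmf N i * s ^ i) {1} \<le> (\<Sum>i. pmf N i * t ^ i - pmf N i * s ^ i)"
    using assms summable
    by (intro sum_le_suminf summable_diff) (auto intro!: mult_left_mono power_mono)
  also have "\<dots> = pgf N t - pgf N s"
    unfolding pgf_def by (rule suminf_diff[OF summable, symmetric])
  finally show ?thesis by (simp add: algebra_simps)
qed

lemma unit_reparam_pgf:
  assumes "positive_valued N" "pmf N 1 > 0"
  shows "unit_reparam (pgf N)"
proof -
  have "pgf N s < pgf N t" if "s \<in> {0..1}" "t \<in> {0..1}" "s < t" for s t
    using pgf_increment_ge[of s t N] mult_pos_pos[OF assms(2), of "t - s"] that by auto
  then show ?thesis
    using assms by (auto simp: unit_reparam_def pgf_0 pgf_1 continuous_on_pgf intro: strict_mono_onI)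
qed

lemma pgf_le_self:
  assumes "positive_valued N" "t \<in> {0..1}"
  shows "pgf N t \<le> t"
proof -
  have "pgf N t \<le> (\<Sum>i. pmf N i * t)"
    unfolding pgf_def
  proof (rule suminf_le)
    fix i show "pmf N i * t ^ i \<le> pmf N i * t"
    proof (cases i)
      case 0 then show ?thesis using assms(1) by (simp add: positive_valued_def)
    next
      case (Suc j) then show ?thesis
        using assms(2) power_le_one[of t j] by (auto intro!: mult_left_mono mult_left_le)
    qed
  qed (use assms sums_mult2[OF sums_pmf_nat] sums_summable in \<open>auto intro: summable_pgf\<close>)
  also have "\<dots> = t" using sums_mult2[OF sums_pmf_nat, of N t] by (simp add: sums_iff)
  finally show ?thesis .
qed

text \<open>
  \<open>Pr(N = 1)\<close> is the derivative of the pgf at 0, which turns statements about pgfs near 0 into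
  statements about \<open>\<eta>\<close>.
\<close>

lemma pgf_quotient_tendsto:
  assumes "positive_valued N"
  shows "((\<lambda>t. pgf N t / t) \<longlongrightarrow> pmf N 1) (at_right 0)"
proof -
  have "((\<lambda>t. pgf N t / t) \<longlongrightarrow> pmf N (Suc 0)) (at 0)"
  proof (rule powser_limit_0_strong[where a="\<lambda>n. pmf N (Suc n)" and s=1])
    fix t :: real assume t: "t \<noteq> 0" "norm t < 1"
    have "(\<lambda>i. pmf N i * t ^ i) sums pgf N t"
      unfolding pgf_def using t by (intro summable_sums summable_pgf) simp
    then have "(\<lambda>n. pmf N (Suc n) * t ^ Suc n) sums pgf N t"
      using assms by (subst sums_Suc_iff) (simp add: positive_valued_def)
    then have "(\<lambda>n. pmf N (Suc n) * t ^ Suc n / t) sums (pgf N t / t)"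
      by (rule sums_divide)
    then show "(\<lambda>n. pmf N (Suc n) * t ^ n) sums (pgf N t / t)"
      using t(1) by simp
  qed simp
  then show ?thesis
    using tendsto_mono[OF at_le[of "{0<..}" UNIV 0]] by simp
qed

lemma eventually_at_right_0_unit: "eventually (\<lambda>t::real. t \<in> {0<..<1}) (at_right 0)"
  using eventually_at_right_real[of 0 1] by simp

lemma pmf_1_le_if_pgf_le:
  assumes "positive_valued N" "positive_valued M" "\<And>t. t \<in> {0..1} \<Longrightarrow> pgf N t \<le> pgf M t"
  shows "pmf N 1 \<le> pmf M 1"
proof (rule tendsto_le[OF _ pgf_quotient_tendsto[OF assms(2)] pgf_quotient_tendsto[OF assms(1)]])
  show "eventually (\<lambda>t. pgf N t / t \<le> pgf M t / t) (at_right 0)"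
    using eventually_at_right_0_unit by eventually_elim (auto intro!: divide_right_mono assms(3))
qed simp

text \<open>
  The chain rule at 0, which is a fixed point of the pgfs; both derivatives are taken from the right.
\<close>

lemma pmf_1_composition:
  assumes "positive_valued K" "positive_valued N" "positive_valued M" "pmf M 1 > 0"
    and comp: "\<And>t. t \<in> {0..1} \<Longrightarrow> pgf K t = pgf N (pgf M t)"
  shows "pmf K 1 = pmf N 1 * pmf M 1"
proof (rule tendsto_unique[OF _ pgf_quotient_tendsto[OF assms(1)]])
  have M: "unit_reparam (pgf M)" using assms by (intro unit_reparam_pgf)
  have M_pos: "eventually (\<lambda>t. pgf M t > 0) (at_right 0)"
    using eventually_at_right_0_unit
    by eventually_elim (use unit_reparam_less[OF M, of 0] M in \<open>auto simp: unit_reparam_def\<close>)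
  have "(pgf M \<longlongrightarrow> 0) (at_right 0)"
  proof (rule tendsto_sandwich[of "\<lambda>_. 0" _ _ "\<lambda>t. t"])
    show "eventually (\<lambda>t. pgf M t \<le> t) (at_right 0)"
      using eventually_at_right_0_unit by eventually_elim (auto intro!: pgf_le_self assms)
    show "eventually (\<lambda>t. 0 \<le> pgf M t) (at_right 0)"
      using M_pos by eventually_elim simp
  qed (auto intro!: tendsto_eq_intros)
  then have "filterlim (pgf M) (at_right 0) (at_right 0)"
    using M_pos by (auto simp: filterlim_at elim: eventually_mono)
  from filterlim_compose[OF pgf_quotient_tendsto[OF assms(2)] this]
  have "((\<lambda>t. pgf N (pgf M t) / pgf M t * (pgf M t / t)) \<longlongrightarrow> pmf N 1 * pmf M 1) (at_right 0)"
    by (intro tendsto_mult pgf_quotient_tendsto assms)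
  moreover have "eventually (\<lambda>t. pgf N (pgf M t) / pgf M t * (pgf M t / t) = pgf K t / t) (at_right 0)"
    using eventually_at_right_0_unit M_pos by eventually_elim (simp add: comp)
  ultimately show "((\<lambda>t. pgf K t / t) \<longlongrightarrow> pmf N 1 * pmf M 1) (at_right 0)"
    by (rule Lim_transform_eventually)
qed simp

section \<open>Models closed under composition of pgfs\<close>

definition eta :: "nat pmf \<Rightarrow> real" where
  "eta N = - ln (pmf N 1)"

locale eta_model =
  fixes \<N> :: "nat pmf set"
  assumes stopping: "stopping_model \<N>"
    and closed: "closed_under_pgf_composition \<N>"
    and eta: "eta_parametrized \<N>"
begin

lemma positive: "N \<in> \<N> \<Longrightarrow> positive_valued N"
  using stopping by (simp add: stopping_model_def)

lemma pmf_1_pos: "N \<in> \<N> \<Longrightarrow> pmf N 1 > 0"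
  using eta by (simp add: eta_parametrized_def)

lemma reparam: "N \<in> \<N> \<Longrightarrow> unit_reparam (pgf N)"
  by (rule unit_reparam_pgf[OF positive pmf_1_pos])

lemma conj_reparam: "N \<in> \<N> \<Longrightarrow> unit_reparam (conj_pgf N)"
  using unit_reparam_conjugate[OF reparam] by (simp add: conj_pgf_def[abs_def])

lemma eta_nonneg: "N \<in> \<N> \<Longrightarrow> eta N \<ge> 0"
  using pmf_1_pos pmf_le_1 by (simp add: eta_def)

lemma eta_inj: "N \<in> \<N> \<Longrightarrow> M \<in> \<N> \<Longrightarrow> eta N = eta M \<Longrightarrow> N = M"
  using eta unfolding eta_parametrized_def bij_betw_def eta_def by (blast dest: inj_onD)

lemma eta_range: "\<exists>\<eta>0\<ge>0. eta ` \<N> = {\<eta>0..}"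
  using eta by (auto simp: eta_parametrized_def bij_betw_def eta_def[abs_def])

lemma eta_composition:
  assumes "K \<in> \<N>" "N \<in> \<N>" "M \<in> \<N>" "\<And>t. t \<in> {0..1} \<Longrightarrow> pgf K t = pgf N (pgf M t)"
  shows "eta K = eta N + eta M"
proof -
  have "pmf K 1 = pmf N 1 * pmf M 1"
    using assms by (intro pmf_1_composition positive pmf_1_pos)
  then show ?thesis
    using pmf_1_pos[OF assms(2)] pmf_1_pos[OF assms(3)] by (simp add: eta_def ln_mult)
qed

lemma composition:
  assumes "N \<in> \<N>" "M \<in> \<N>"
  shows "\<exists>K\<in>\<N>. (\<forall>t\<in>{0..1}. pgf K t = pgf N (pgf M t)) \<and> eta K = eta N + eta M"
  using closed assms eta_composition unfolding closed_under_pgf_composition_def by metis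

text \<open>
  A decomposition of \<open>\<eta>\<close> is a factorization of the pgf,
  because the composition in the model has the same \<open>\<eta>\<close> and therefore the same law.
\<close>

lemma pgf_composition_if_eta_add:
  assumes "K \<in> \<N>" "N \<in> \<N>" "M \<in> \<N>" "eta K = eta N + eta M" "t \<in> {0..1}"
  shows "pgf K t = pgf N (pgf M t)"
  using composition[OF assms(2,3)] eta_inj assms by metis

lemma pgf_commute:
  assumes "N \<in> \<N>" "M \<in> \<N>" "t \<in> {0..1}"
  shows "pgf N (pgf M t) = pgf M (pgf N t)"
proof -
  obtain K where K: "K \<in> \<N>" "\<And>t. t \<in> {0..1} \<Longrightarrow> pgf K t = pgf N (pgf M t)" "eta K = eta N + eta M"
    using composition[OF assms(1,2)] by blast
  then show ?thesis
    using pgf_composition_if_eta_add[of K M N t] assms by simp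
qed

lemma nonempty: "\<N> \<noteq> {}"
  using eta_range by auto

sublocale pgfs: commuting_reparams "pgf ` \<N>"
proof
  fix f g assume "f \<in> pgf ` \<N>" "g \<in> pgf ` \<N>"
  then show "\<exists>h\<in>pgf ` \<N>. \<forall>t\<in>{0..1}. h t = f (g t)"
    using closed by (auto simp: closed_under_pgf_composition_def)
qed (use nonempty reparam pgf_commute in auto)

sublocale conj_pgfs: commuting_reparams "conj_pgf ` \<N>"
proof
  fix f g assume "f \<in> conj_pgf ` \<N>" "g \<in> conj_pgf ` \<N>"
  then show "\<exists>h\<in>conj_pgf ` \<N>. \<forall>t\<in>{0..1}. h t = f (g t)"
    using closed by (fastforce simp: closed_under_pgf_composition_def conj_pgf_def)
qed (use nonempty conj_reparam pgf_commute in \<open>auto simp: conj_pgf_def\<close>)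

lemma max_max_inv_eq: "max_max_inv \<N> = (\<lambda>\<X>\<in>statistical_models. quotient_tr (pgf ` \<N>) \<X>)"
  unfolding max_max_inv_def max_tr_def max_inv_tr_def quotient_tr_def pgf_inv_def
  by (intro restrict_ext) blast

lemma max_inv_max_eq: "max_inv_max \<N> = max_max_inv \<N>"
proof -
  have "max_inv_tr \<N> (max_tr \<N> \<X>) = quotient_tr (pgf ` \<N>) \<X>" if "\<X> \<in> statistical_models" for \<X>
    unfolding max_tr_def max_inv_tr_def pgf_inv_def pgfs.quotient_tr_swap[OF that] by blast
  then show ?thesis
    unfolding max_max_inv_eq max_inv_max_def by (intro restrict_ext)
qed

lemma min_min_inv_eq: "min_min_inv \<N> = (\<lambda>\<X>\<in>statistical_models. quotient_tr (conj_pgf ` \<N>) \<X>)"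
  unfolding min_min_inv_def min_tr_def min_inv_tr_def quotient_tr_def conj_pgf_inv_def
  by (intro restrict_ext) blast

lemma min_inv_min_eq: "min_inv_min \<N> = min_min_inv \<N>"
proof -
  have "min_inv_tr \<N> (min_tr \<N> \<X>) = quotient_tr (conj_pgf ` \<N>) \<X>" if "\<X> \<in> statistical_models" for \<X>
    unfolding min_tr_def min_inv_tr_def conj_pgf_inv_def conj_pgfs.quotient_tr_swap[OF that] by blast
  then show ?thesis
    unfolding min_min_inv_eq min_inv_min_def by (intro restrict_ext)
qed

lemma stable_extensions: "stable_extension (max_max_inv \<N>)" "stable_extension (min_min_inv \<N>)"
  unfolding max_max_inv_eq min_min_inv_eq
  by (rule pgfs.stable_quotient_tr conj_pgfs.stable_quotient_tr)+

end

lemma eta_model_if_uniparametric_pgf_closed: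
  "uniparametric_pgf_closed \<N> \<Longrightarrow> eta_parametrized \<N> \<Longrightarrow> eta_model \<N>"
  by (simp add: eta_model_def uniparametric_pgf_closed_def)

section \<open>Coarsely monotone additive relations\<close>

text \<open>
  If the ratios \<open>y / x\<close> and \<open>v / u\<close> differed, then suitable multiples of the two pairs would be ordered
  oppositely in the two coordinates. Large multiples make the gap in the first coordinate exceed \<open>d\<close>,
  which contradicts \<open>mono\<close>.
\<close>

lemma coarsely_monotone_additive_proportional:
  fixes P :: "(real \<times> real) set" and d :: real
  assumes nonneg: "\<And>x y. (x, y) \<in> P \<Longrightarrow> 0 \<le> x \<and> 0 \<le> y"
    and add: "\<And>x y u v. (x, y) \<in> P \<Longrightarrow> (u, v) \<in> P \<Longrightarrow> (x + u, y + v) \<in> P"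
    and mono: "\<And>x y u v. (x, y) \<in> P \<Longrightarrow> (u, v) \<in> P \<Longrightarrow> u + d \<le> x \<Longrightarrow> v \<le> y"
    and mem: "(x, y) \<in> P" "(u, v) \<in> P"
  shows "x * v = u * y"
proof -
  have multiple: "(real (Suc n) * x, real (Suc n) * y) \<in> P" if "(x, y) \<in> P" for x y n
  proof (induction n)
    case (Suc n)
    from add[OF this that] show ?case by (simp add: algebra_simps)
  qed (use that in simp)
  have le: "x * v \<le> u * y" if P: "(x, y) \<in> P" "(u, v) \<in> P" for x y u v
  proof (rule ccontr)
    assume "\<not> x * v \<le> u * y"
    then have less: "u * y < x * v" by simp
    have pos: "0 \<le> x" "0 \<le> y" "0 \<le> u" "0 \<le> v" using nonneg[OF P(1)] nonneg[OF P(2)] by auto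
    have v: "v > 0"
      using less pos mult_nonneg_nonneg[OF pos(3,2)] by (cases "v = 0") auto
    define e where "e = x - u * y / v"
    have "0 < e" using less v by (simp add: e_def field_simps)
    then obtain n0 where n0: "u + d < real n0 * e"
      using reals_Archimedean3 by blast
    define n where "n = Suc n0"
    have n: "u + d < real n * e"
      using n0 \<open>0 < e\<close> by (simp add: n_def algebra_simps)
    \<comment> \<open>\<open>(k + 1) v\<close> is the least multiple of \<open>v\<close> above \<open>n y\<close>; the gap \<open>n x - (k + 1) u\<close> is at least \<open>n e - u\<close>.\<close>
    define k where "k = nat \<lfloor>real n * y / v\<rfloor>"
    have q0: "0 \<le> real n * y / v" using pos by simp
    have k: "real n * y / v < real (Suc k)" "real (Suc k) \<le> real n * y / v + 1"
      using q0 by (simp_all add: k_def) linarith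
    have "real (Suc k) * u + d \<le> (real n * y / v + 1) * u + d"
      using k(2) pos by (intro add_right_mono mult_right_mono) auto
    also have "\<dots> = real n * (u * y / v) + (u + d)" by (simp add: algebra_simps)
    also have "\<dots> \<le> real n * x" using n by (simp add: e_def algebra_simps)
    finally have "real (Suc k) * v \<le> real n * y"
      using mono[OF multiple[OF P(1), of n0] multiple[OF P(2), of k]] by (simp add: n_def)
    moreover have "real n * y < real (Suc k) * v" using k(1) v by (simp add: field_simps)
    ultimately show False by simp
  qed
  show ?thesis using le[OF mem] le[OF mem(2,1)] by (simp add: mult.commute)
qed

section \<open>Extreme reversible pairs\<close>

locale reversible_eta_models = N: eta_model \<N> + N': eta_model \<N>' for \<N> \<N>' +
  assumes reversible: "extreme_reversible_models \<N> \<N>'"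
begin

lemma partner:
  assumes "N' \<in> \<N>'"
  obtains N where "N \<in> \<N>" "extreme_reversible N N'"
  using assms reversible by (auto simp: extreme_reversible_models_def)

lemma conj_pgf_partner:
  assumes "N \<in> \<N>" "extreme_reversible N N'" "t \<in> {0..1}"
  shows "conj_pgf N (pgf N' t) = t" "pgf N' (conj_pgf N t) = t"
proof -
  have inv: "pgf N' s = unit_inv (conj_pgf N) s" if "s \<in> {0..1}" for s
    using assms(2) that by (simp add: extreme_reversible_def conj_pgf_inv_def)
  note N = N.conj_reparam[OF assms(1)]
  show "conj_pgf N (pgf N' t) = t"
    using inv[OF assms(3)] reparam_unit_inv[OF N assms(3)] by simp
  show "pgf N' (conj_pgf N t) = t"
    using inv[OF unit_reparam_mem[OF N assms(3)]] unit_inv_eqI[OF N assms(3)] by simp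
qed

lemma extreme_reversibleI:
  assumes "N \<in> \<N>" "N' \<in> \<N>'" "\<And>t. t \<in> {0..1} \<Longrightarrow> conj_pgf N (pgf N' t) = t"
  shows "extreme_reversible N N'"
proof -
  have "conj_pgf_inv N t = pgf N' t" if "t \<in> {0..1}" for t
    unfolding conj_pgf_inv_def
    using unit_inv_eqI[OF N.conj_reparam[OF assms(1)]] assms(3)[OF that]
      unit_reparam_mem[OF N'.reparam[OF assms(2)] that] by blast
  then show ?thesis
    using assms(1,2) by (simp add: extreme_reversible_def N.positive N'.positive)
qed

lemma pgf_partner:
  assumes "N \<in> \<N>" "extreme_reversible N N'" "t \<in> {0..1}"
  shows "conj_pgf N' (pgf N t) = t" "pgf N (conj_pgf N' t) = t"
  using conj_pgf_partner[OF assms(1,2), of "1 - t"] assms(3) by (auto simp: conj_pgf_def)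

text \<open>
  A relation, not a function of the first parameter, since some members of \<open>\<N>\<close> may lack a partner.
\<close>

definition partner_etas :: "(real \<times> real) set" where
  "partner_etas = {(eta N, eta N') | N N'. N \<in> \<N> \<and> N' \<in> \<N>' \<and> extreme_reversible N N'}"

lemma partner_etasI:
  "N \<in> \<N> \<Longrightarrow> N' \<in> \<N>' \<Longrightarrow> extreme_reversible N N' \<Longrightarrow> (eta N, eta N') \<in> partner_etas"
  by (auto simp: partner_etas_def)

text \<open>
  Inversion reverses the order of composition, so the partner of \<open>N \<circ> M\<close> is built from \<open>M' \<circ> N'\<close>.
\<close>

lemma partner_etas_add:
  assumes "(x, y) \<in> partner_etas" "(u, v) \<in> partner_etas"
  shows "(x + u, y + v) \<in> partner_etas"
proof -
  obtain N N' where N: "N \<in> \<N>" "N' \<in> \<N>'" "extreme_reversible N N'" "x = eta N" "y = eta N'"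
    using assms(1) by (auto simp: partner_etas_def)
  obtain M M' where M: "M \<in> \<N>" "M' \<in> \<N>'" "extreme_reversible M M'" "u = eta M" "v = eta M'"
    using assms(2) by (auto simp: partner_etas_def)
  obtain K where K: "K \<in> \<N>" "\<And>t. t \<in> {0..1} \<Longrightarrow> pgf K t = pgf N (pgf M t)" "eta K = eta N + eta M"
    using N.composition[OF N(1) M(1)] by blast
  obtain K' where K': "K' \<in> \<N>'" "\<And>t. t \<in> {0..1} \<Longrightarrow> pgf K' t = pgf M' (pgf N' t)"
    "eta K' = eta M' + eta N'"
    using N'.composition[OF M(2) N(2)] by blast
  have "conj_pgf K (pgf K' t) = t" if t: "t \<in> {0..1}" for t
  proof -
    have s: "pgf N' t \<in> {0..1}" using unit_reparam_mem[OF N'.reparam[OF N(2)] t] .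
    have "conj_pgf K (pgf K' t) = conj_pgf N (conj_pgf M (pgf K' t))"
      using K(2)[of "1 - pgf K' t"] unit_reparam_mem[OF N'.reparam[OF K'(1)] t]
      by (simp add: conj_pgf_def)
    also have "\<dots> = conj_pgf N (pgf N' t)"
      using K'(2)[OF t] conj_pgf_partner(1)[OF M(1,3) s] by simp
    also have "\<dots> = t" using conj_pgf_partner(1)[OF N(1,3) t] .
    finally show ?thesis .
  qed
  then have "extreme_reversible K K'" by (rule extreme_reversibleI[OF K(1) K'(1)])
  from partner_etasI[OF K(1) K'(1) this] show ?thesis
    using K(3) K'(3) N(4,5) M(4,5) by (simp add: add.commute)
qed

text \<open>
  Conjugation reverses the order of pgfs and inversion reverses it again. The resulting
  inequality between the partner pgfs is then read off from their derivatives at 0.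
\<close>

lemma partner_pgf_antimono:
  assumes "N \<in> \<N>" "N' \<in> \<N>'" "extreme_reversible N N'"
    and "M \<in> \<N>" "M' \<in> \<N>'" "extreme_reversible M M'"
    and le: "\<And>t. t \<in> {0..1} \<Longrightarrow> pgf N t \<le> pgf M t"
  shows "eta M' \<le> eta N'"
proof -
  have "pgf N' t \<le> pgf M' t" if t: "t \<in> {0..1}" for t
  proof -
    have mem: "pgf N' t \<in> {0..1}" "pgf M' t \<in> {0..1}"
      using unit_reparam_mem[OF N'.reparam t] assms(2,5) by auto
    have "conj_pgf M (pgf N' t) \<le> conj_pgf N (pgf N' t)"
      using le[of "1 - pgf N' t"] mem by (simp add: conj_pgf_def)
    also have "\<dots> = conj_pgf M (pgf M' t)"
      using conj_pgf_partner(1)[OF assms(1,3) t] conj_pgf_partner(1)[OF assms(4,6) t] by simp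
    finally show ?thesis
      using unit_reparam_le[OF N.conj_reparam[OF assms(4)] mem] by simp
  qed
  then have "pmf N' 1 \<le> pmf M' 1"
    using assms by (intro pmf_1_le_if_pgf_le) (auto intro: N'.positive)
  then show ?thesis
    using N'.pmf_1_pos[OF assms(2)] by (simp add: eta_def)
qed

text \<open>
  The slack \<open>d\<close> is the least parameter in \<open>\<N>\<close>: if \<open>x\<close> exceeds \<open>u\<close> by at least \<open>d\<close>, then the difference
  belongs to a pgf, which lies below the identity, and composing with it yields the pgf for \<open>x\<close>.
\<close>

lemma partner_etas_mono:
  assumes d: "eta ` \<N> = {d..}"
    and "(x, y) \<in> partner_etas" "(u, v) \<in> partner_etas" "u + d \<le> x"
  shows "v \<le> y"
proof -
  obtain N N' where N: "N \<in> \<N>" "N' \<in> \<N>'" "extreme_reversible N N'" "x = eta N" "y = eta N'"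
    using assms(2) by (auto simp: partner_etas_def)
  obtain M M' where M: "M \<in> \<N>" "M' \<in> \<N>'" "extreme_reversible M M'" "u = eta M" "v = eta M'"
    using assms(3) by (auto simp: partner_etas_def)
  have "x - u \<in> eta ` \<N>" using d assms(4) by simp
  then obtain K where K: "K \<in> \<N>" "eta K = x - u" by auto
  have "pgf N t \<le> pgf M t" if t: "t \<in> {0..1}" for t
  proof -
    have "pgf N t = pgf K (pgf M t)"
      using N.pgf_composition_if_eta_add[OF N(1) K(1) M(1) _ t] N(4) M(4) K(2) by simp
    also have "\<dots> \<le> pgf M t"
      using pgf_le_self[OF N.positive[OF K(1)]] unit_reparam_mem[OF N.reparam[OF M(1)] t] by blast
    finally show ?thesis .
  qed
  then show ?thesis
    using partner_pgf_antimono[OF N(1-3) M(1-3)] N(5) M(5) by simp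
qed

lemma partner_etas_unique:
  assumes "(x, y) \<in> partner_etas" "(x, z) \<in> partner_etas"
  shows "y = z"
proof -
  have "z \<le> y" if xy: "(x, y) \<in> partner_etas" and xz: "(x, z) \<in> partner_etas" for y z
  proof -
    obtain N N' where N: "N \<in> \<N>" "N' \<in> \<N>'" "extreme_reversible N N'" "x = eta N" "y = eta N'"
      using xy by (auto simp: partner_etas_def)
    obtain M M' where M: "M \<in> \<N>" "M' \<in> \<N>'" "extreme_reversible M M'" "x = eta M" "z = eta M'"
      using xz by (auto simp: partner_etas_def)
    have "N = M" using N.eta_inj[OF N(1) M(1)] N(4) M(4) by simp
    then show ?thesis using partner_pgf_antimono[OF N(1-3) M(1-3)] N(5) M(5) by simp
  qed
  then show ?thesis using assms by (meson order_antisym)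
qed

lemma partner_etas_linear:
  "\<exists>c>0. \<forall>(x, y)\<in>partner_etas. y = c * x"
proof -
  obtain d where d: "eta ` \<N> = {d..}" using N.eta_range by blast
  obtain d' where d': "d' \<ge> 0" "eta ` \<N>' = {d'..}" using N'.eta_range by blast
  have nonneg: "0 \<le> x \<and> 0 \<le> y" if "(x, y) \<in> partner_etas" for x y
    using that N.eta_nonneg N'.eta_nonneg by (auto simp: partner_etas_def)
  \<comment> \<open>A partner pair with a nonzero second parameter, which fixes the slope.\<close>
  have "d' + 1 \<in> eta ` \<N>'" using d' by simp
  then obtain N' where N': "N' \<in> \<N>'" "eta N' = d' + 1" by auto
  obtain N where "N \<in> \<N>" "extreme_reversible N N'" using partner[OF N'(1)] .
  then have mem: "(eta N, d' + 1) \<in> partner_etas" using partner_etasI[of N N'] N' by simp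
  have "eta N \<noteq> 0"
  proof
    assume "eta N = 0"
    \<comment> \<open>Then doubling the pair changes the second parameter only.\<close>
    then have "(eta N, 2 * (d' + 1)) \<in> partner_etas"
      using partner_etas_add[OF mem mem] by (simp add: algebra_simps)
    from partner_etas_unique[OF mem this] show False using d'(1) by simp
  qed
  then have pos: "eta N > 0" using nonneg[OF mem] by simp
  have "y = (d' + 1) / eta N * x" if xy: "(x, y) \<in> partner_etas" for x y
  proof -
    have "eta N * y = x * (d' + 1)"
      by (rule coarsely_monotone_additive_proportional[where P=partner_etas and d=d])
        (fact nonneg partner_etas_add partner_etas_mono[OF d] mem xy)+
    then show ?thesis using pos by (simp add: field_simps)
  qed
  moreover have "(d' + 1) / eta N > 0" using pos d'(1) by simp
  ultimately show ?thesis by blast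
qed

text \<open>
  If \<open>\<eta>\<close> is large, \<open>c \<eta>\<close> is the parameter of a member of \<open>\<N>'\<close>, which is the partner of something
  in \<open>\<N>\<close>. By linearity that element has parameter \<open>\<eta>\<close>, so it is the given one.
\<close>

lemma partners_eventually:
  "\<exists>a. \<forall>N\<in>\<N>. a \<le> eta N \<longrightarrow> (\<exists>N'\<in>\<N>'. extreme_reversible N N')"
proof -
  obtain d' where d': "eta ` \<N>' = {d'..}" using N'.eta_range by blast
  obtain c where c: "c > 0" "\<And>x y. (x, y) \<in> partner_etas \<Longrightarrow> y = c * x"
    using partner_etas_linear by blast
  show ?thesis
  proof (intro exI ballI impI)
    fix N assume N: "N \<in> \<N>" "d' / c \<le> eta N"
    then have "c * eta N \<in> eta ` \<N>'" using d' c(1) by (simp add: field_simps)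
    then obtain N' where N': "N' \<in> \<N>'" "eta N' = c * eta N" by auto
    obtain M where M: "M \<in> \<N>" "extreme_reversible M N'" using partner[OF N'(1)] .
    then have "(eta M, eta N') \<in> partner_etas" using partner_etasI N'(1) by blast
    then have "eta M = eta N" using c N'(2) by fastforce
    then have "M = N" using N.eta_inj M(1) N(1) by blast
    then show "\<exists>N'\<in>\<N>'. extreme_reversible N N'" using M(2) N'(1) by blast
  qed
qed

lemma common_factor_with_partners:
  assumes "N \<in> \<N>" "M \<in> \<N>"
  obtains K N' M' where "K \<in> \<N>" "N' \<in> \<N>'" "M' \<in> \<N>'"
    "\<And>t. t \<in> {0..1} \<Longrightarrow> pgf N' (conj_pgf N (conj_pgf K t)) = t"
    "\<And>t. t \<in> {0..1} \<Longrightarrow> pgf M' (conj_pgf M (conj_pgf K t)) = t"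
    "\<And>t. t \<in> {0..1} \<Longrightarrow> conj_pgf N' (pgf N (pgf K t)) = t"
    "\<And>t. t \<in> {0..1} \<Longrightarrow> conj_pgf M' (pgf M (pgf K t)) = t"
proof -
  obtain a where a: "\<And>N. N \<in> \<N> \<Longrightarrow> a \<le> eta N \<Longrightarrow> \<exists>N'\<in>\<N>'. extreme_reversible N N'"
    using partners_eventually by blast
  obtain d where d: "eta ` \<N> = {d..}" using N.eta_range by blast
  then have "max a d \<in> eta ` \<N>" by simp
  then obtain K where K: "K \<in> \<N>" "a \<le> eta K" by auto
  have *: "\<exists>N'\<in>\<N>'. \<forall>t\<in>{0..1}. pgf N' (conj_pgf N (conj_pgf K t)) = t \<and>
      conj_pgf N' (pgf N (pgf K t)) = t" if N: "N \<in> \<N>" for N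
  proof -
    obtain L where L: "L \<in> \<N>" "\<And>t. t \<in> {0..1} \<Longrightarrow> pgf L t = pgf N (pgf K t)" "eta L = eta N + eta K"
      using N.composition[OF N K(1)] by blast
    have "a \<le> eta L" using L(3) K(2) N.eta_nonneg[OF N] by simp
    then obtain N' where N': "N' \<in> \<N>'" "extreme_reversible L N'" using a[OF L(1)] by blast
    have "conj_pgf L t = conj_pgf N (conj_pgf K t)" if "t \<in> {0..1}" for t
      using L(2)[of "1 - t"] that by (simp add: conj_pgf_def)
    then show ?thesis
      using N'(1) L(2) conj_pgf_partner(2)[OF L(1) N'(2)] pgf_partner(1)[OF L(1) N'(2)]
      by (metis (no_types, lifting))
  qed
  show thesis
    using *[OF assms(1)] *[OF assms(2)] K(1) that by blast
qed

lemma max_max_inv_reversed: "max_max_inv \<N>' = min_min_inv \<N>"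
proof -
  have "quotient_tr (pgf ` \<N>') \<X> = quotient_tr (conj_pgf ` \<N>) \<X>" if "\<X> \<in> statistical_models" for \<X>
  proof (rule quotient_tr_eq_of_cofinal_inverses[OF _ _ _ _ that])
    fix f' assume "f' \<in> pgf ` \<N>'"
    then obtain N' where N': "N' \<in> \<N>'" "f' = pgf N'" by blast
    obtain N where "N \<in> \<N>" "extreme_reversible N N'" using partner[OF N'(1)] .
    then show "\<exists>f\<in>conj_pgf ` \<N>. \<forall>t\<in>{0..1}. f' t = unit_inv f t"
      unfolding extreme_reversible_def conj_pgf_inv_def N'(2) by force
  next
    fix f g assume "f \<in> conj_pgf ` \<N>" "g \<in> conj_pgf ` \<N>"
    then obtain N M where NM: "N \<in> \<N>" "M \<in> \<N>" and fg: "f = conj_pgf N" "g = conj_pgf M" by blast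
    show "\<exists>k\<in>conj_pgf ` \<N>. \<exists>f'\<in>pgf ` \<N>'. \<exists>g'\<in>pgf ` \<N>'.
        \<forall>t\<in>{0..1}. f' (f (k t)) = t \<and> g' (g (k t)) = t"
      by (rule common_factor_with_partners[OF NM]) (use fg in blast)
  qed unfold_locales
  then show ?thesis
    unfolding N'.max_max_inv_eq N.min_min_inv_eq by (intro restrict_ext)
qed

lemma min_min_inv_reversed: "min_min_inv \<N>' = max_max_inv \<N>"
proof -
  have "quotient_tr (conj_pgf ` \<N>') \<X> = quotient_tr (pgf ` \<N>) \<X>" if "\<X> \<in> statistical_models" for \<X>
  proof (rule quotient_tr_eq_of_cofinal_inverses[OF _ _ _ _ that])
    fix f' assume "f' \<in> conj_pgf ` \<N>'"
    then obtain N' where N': "N' \<in> \<N>'" "f' = conj_pgf N'" by blast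
    obtain N where N: "N \<in> \<N>" "extreme_reversible N N'" using partner[OF N'(1)] .
    have "conj_pgf N' t = unit_inv (pgf N) t" if t: "t \<in> {0..1}" for t
      using unit_inv_eqI[OF N.reparam[OF N(1)] _ pgf_partner(2)[OF N t]]
        unit_reparam_mem[OF N'.conj_reparam[OF N'(1)] t] by simp
    then show "\<exists>f\<in>pgf ` \<N>. \<forall>t\<in>{0..1}. f' t = unit_inv f t"
      using N'(2) N(1) by blast
  next
    fix f g assume "f \<in> pgf ` \<N>" "g \<in> pgf ` \<N>"
    then obtain N M where NM: "N \<in> \<N>" "M \<in> \<N>" and fg: "f = pgf N" "g = pgf M" by blast
    show "\<exists>k\<in>pgf ` \<N>. \<exists>f'\<in>conj_pgf ` \<N>'. \<exists>g'\<in>conj_pgf ` \<N>'.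
        \<forall>t\<in>{0..1}. f' (f (k t)) = t \<and> g' (g (k t)) = t"
      by (rule common_factor_with_partners[OF NM]) (use fg in blast)
  qed unfold_locales
  then show ?thesis
    unfolding N'.min_min_inv_eq N.max_max_inv_eq by (intro restrict_ext)
qed

end

theorem proposition9:
  fixes \<N> \<N>' :: "nat pmf set"
  assumes "uniparametric_pgf_closed \<N>" and "eta_parametrized \<N>"
    and "uniparametric_pgf_closed \<N>'" and "eta_parametrized \<N>'"
    and "extreme_reversible_models \<N> \<N>'"
  shows "max_max_inv \<N> = max_inv_max \<N> \<and> stable_extension (max_max_inv \<N>) \<and>
         min_min_inv \<N> = min_inv_min \<N> \<and> stable_extension (min_min_inv \<N>) \<and>
         max_max_inv \<N>' = max_inv_max \<N>' \<and> stable_extension (max_max_inv \<N>') \<and>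
         min_min_inv \<N>' = min_inv_min \<N>' \<and> stable_extension (min_min_inv \<N>') \<and>
         {max_max_inv \<N>, min_min_inv \<N>} = {max_max_inv \<N>', min_min_inv \<N>'}"
proof -
  interpret reversible_eta_models \<N> \<N>'
    using assms
    by (simp add: reversible_eta_models_def reversible_eta_models_axioms_def
        eta_model_if_uniparametric_pgf_closed)
  show ?thesis
    by (simp add: N.max_inv_max_eq N.min_inv_min_eq N'.max_inv_max_eq N'.min_inv_min_eq
        N.stable_extensions N'.stable_extensions max_max_inv_reversed min_min_inv_reversed
        insert_commute)
qed

end
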